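(* Fix $p\in(0,1]$ and, for each $n\ge 3$, let $a,b,s$ be fixed distinct vertices of the random directed graph $\vec G(n,p)$. Then \[ \lim_{n\to\infty}\frac{\mathbb P(a\not\to s,\ s\not\to b)-\mathbb P(a\not\to s)\,\mathbb P(s\not\to b)}{\mathbb P(a\not\to s,\ s\not\to b)}=\frac{2p-1}{3}. \] In particular, for all large enough $n$: (i) if $0<p<1/2$, then $\operatorname{Cov}(s\not\to a,\ b\not\to s)<0$; (ii) if $1/2<p\le 1$, then $\operatorname{Cov}(s\not\to a,\ b\not\to s)>0$. Furthermore, as $n\to\infty$ (with $p$ fixed), \[ \operatorname{Cov}(s\not\to a,\ b\not\to s)=(2p-1+o(1))\,(1-p/2)^{2n-3}. \]
   Context: $G(n,p)$ is the random graph on $n$ labelled vertices in which each of the $\binom n2$ possible edges is present independently with probability $p$. $\vec G(n,p)$ is the random directed graph obtained from $G(n,p)$ by giving each present edge one of its two orientations with probability $1/2$ each, independently of everything else. All probabilities are in the combined (annealed) probability space of the random graph and the orientations. For vertices $u,v$, $\{u\to v\}$ is the event that there is a directed path from $u$ to $v$, and $\{u\not\to v\}$ is its complement. For events $A,B$, $\operatorname{Cov}(A,B):=\mathbb P(A\cap B)-\mathbb P(A)\mathbb P(B)$. *)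

theory Defs
  imports "HOL-Probability.Probability" "HOL-Library.Landau_Symbols"
begin

text \<open>The vertex set is \<^term>\<open>{..<n}\<close>; undirected edges are two-element sets of vertices.\<close>

definition possible_edges :: "nat \<Rightarrow> nat set set" where
  "possible_edges n = {e. e \<subseteq> {..<n} \<and> card e = 2}"

definition random_graph :: "nat \<Rightarrow> real \<Rightarrow> nat set set pmf" where
  "random_graph n p =
     map_pmf (\<lambda>present. {e \<in> possible_edges n. present e})
       (Pi_pmf (possible_edges n) False (\<lambda>_. bernoulli_pmf p))"

text \<open>
  An orientation of an edge set \<open>E\<close> is encoded by a function choosing the head of each edge;
  the pair \<open>(u, v)\<close> stands for the arc from \<open>u\<close> to \<open>v\<close>. The value \<open>0\<close> is the
  irrelevant default of \<^const>\<open>Pi_pmf\<close> outside \<open>E\<close>.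
\<close>

definition orient :: "nat set set \<Rightarrow> (nat set \<Rightarrow> nat) \<Rightarrow> (nat \<times> nat) set" where
  "orient E head = {(u, v). {u, v} \<in> E \<and> u \<noteq> v \<and> head {u, v} = v}"

definition random_orientation :: "nat set set \<Rightarrow> (nat \<times> nat) set pmf" where
  "random_orientation E = map_pmf (orient E) (Pi_pmf E 0 (\<lambda>e. pmf_of_set e))"

text \<open>The annealed law: first sample the graph, then the orientations of its edges.\<close>

definition random_digraph :: "nat \<Rightarrow> real \<Rightarrow> (nat \<times> nat) set pmf" where
  "random_digraph n p = bind_pmf (random_graph n p) random_orientation"

definition directed_path :: "('v \<times> 'v) set \<Rightarrow> 'v \<Rightarrow> 'v list \<Rightarrow> 'v \<Rightarrow> bool" where
  "directed_path D u xs v \<longleftrightarrow>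
     xs \<noteq> [] \<and> hd xs = u \<and> last xs = v \<and> distinct xs \<and> successively (\<lambda>x y. (x, y) \<in> D) xs"

definition path_event :: "'v \<Rightarrow> 'v \<Rightarrow> ('v \<times> 'v) set set" where
  "path_event u v = {D. \<exists>xs. directed_path D u xs v}"

definition no_path_event :: "'v \<Rightarrow> 'v \<Rightarrow> ('v \<times> 'v) set set" where
  "no_path_event u v = - path_event u v"

definition event_cov :: "'a pmf \<Rightarrow> 'a set \<Rightarrow> 'a set \<Rightarrow> real" where
  "event_cov M A B =
     measure_pmf.prob M (A \<inter> B) - measure_pmf.prob M A * measure_pmf.prob M B"

end

theory Submission
  imports Defs
begin

text \<open>
  Write \<open>q = 1 - p / 2\<close> for the probability that a given arc is absent. In the annealed law the
  pairs of vertices are independent, and a pair carries neither arc with probability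
  \<open>1 - p < q\<^sup>2\<close>. So the probability of avoiding a set \<open>F\<close> of arcs is at most \<open>q ^ card F\<close>, with
  equality if \<open>F\<close> never contains both orientations of a pair.

  There is no path from \<open>u\<close> to \<open>v\<close> if and only if some set \<open>U\<close> with \<open>u \<in> U\<close> and \<open>v \<notin> U\<close> has no
  arc leaving it, and such a \<open>U\<close> of size \<open>k\<close> forbids \<open>k * (n - k)\<close> arcs. Since this grows quickly
  with the smaller side, a missing path is almost always explained by \<open>u\<close> having no out-arc or \<open>v\<close>
  having no in-arc, and \<open>P(u \<not>\<rightarrow> v) \<sim> 2 * q ^ (n - 1)\<close>.

  For \<open>a \<not>\<rightarrow> s\<close> and \<open>s \<not>\<rightarrow> b\<close> jointly, a separating set with three or more vertices on both
  sides already costs about \<open>q ^ (3 * n)\<close>, so each of the two separating sets can be assumed to have at most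
  two vertices on one of its sides. Apart from a bounded number of vertices, the forbidden
  arcs are then all arcs out of some vertices and all arcs into some others. If these are at least three
  vertices in total, then about \<open>3 * n\<close> arcs are forbidden, which is negligible against \<open>q ^ (2 * n)\<close>
  even after summing over the \<open>n\<^sup>2\<close> choices of the additional vertices. Exactly four
  configurations remain:
    \<^item> \<open>a\<close> has no out-arc, and \<open>s\<close> has none except possibly to \<open>a\<close>;
    \<^item> \<open>a\<close> has no out-arc, and \<open>b\<close> has no in-arc;
    \<^item> \<open>b\<close> has no in-arc, and \<open>s\<close> has none except possibly from \<open>b\<close>;
    \<^item> \<open>s\<close> is isolated.
  The first three forbid \<open>2 * n - 3\<close> arcs on distinct pairs each and overlap negligibly; the fourth has
  probability \<open>(1 - p) ^ (n - 1)\<close>, negligible because \<open>1 - p < q\<^sup>2\<close> strictly for \<open>p > 0\<close>. So the joint probability is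
  asymptotic to \<open>3 * q ^ (2 * n - 3)\<close>, while the product of the two marginal probabilities is asymptotic
  to \<open>4 * q ^ (2 * n - 2)\<close>. The covariance is therefore \<open>(3 - 4 * q + o(1)) * q ^ (2 * n - 3)\<close>, and
  \<open>3 - 4 * q = 2 * p - 1\<close>.

  The case distinction is made in \<open>no_paths_cases\<close>; \<open>prob_no_path_bounds\<close> and
  \<open>prob_no_paths_bounds\<close> turn it into explicit error bounds.
\<close>

section \<open>The probability of avoiding a set of arcs\<close>

definition arcs_on :: "('v \<times> 'v) set \<Rightarrow> 'v set \<Rightarrow> ('v \<times> 'v) set" where
  "arcs_on F e = {(u, v) \<in> F. u \<noteq> v \<and> {u, v} = e}"

definition avoids :: "('v \<times> 'v) set \<Rightarrow> ('v \<times> 'v) set set" where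
  "avoids F = {D. D \<inter> F = {}}"

lemma avoids_Un [simp]: "avoids (F \<union> G) = avoids F \<inter> avoids G"
  by (auto simp: avoids_def)

lemma avoids_antimono: "F \<subseteq> G \<Longrightarrow> avoids G \<subseteq> avoids F"
  by (auto simp: avoids_def)

lemma prob_bind_pmf:
  "measure_pmf.prob (bind_pmf M f) A = measure_pmf.expectation M (\<lambda>x. measure_pmf.prob (f x) A)"
proof -
  have "ennreal (measure_pmf.prob (bind_pmf M f) A) = emeasure (bind_pmf M f) A"
    by (simp add: measure_pmf.emeasure_eq_measure)
  also have "\<dots> = (\<integral>\<^sup>+x. emeasure (f x) A \<partial>M)"
    by simp
  also have "\<dots> = (\<integral>\<^sup>+x. ennreal (measure_pmf.prob (f x) A) \<partial>M)"
    by (simp only: measure_pmf.emeasure_eq_measure)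
  also have "\<dots> = ennreal (measure_pmf.expectation M (\<lambda>x. measure_pmf.prob (f x) A))"
    by (intro nn_integral_eq_integral measure_pmf.integrable_const_bound[where B=1]) auto
  finally show ?thesis
    by (simp add: integral_nonneg_AE)
qed

lemma finite_possible_edges [simp, intro]: "finite (possible_edges n)"
  by (rule finite_subset[of _ "Pow {..<n}"]) (auto simp: possible_edges_def)

lemma card_filter_pair:
  assumes "x \<noteq> y"
  shows "card {v \<in> {x, y}. P v} = (if P x then 1 else 0) + (if P y then 1 else 0)"
proof -
  have "{v \<in> {x, y}. P v} = (if P x then {x} else {}) \<union> (if P y then {y} else {})"
    by auto
  then show ?thesis
    using assms by simp
qed

text \<open>
  The head of an edge is uniform among its two ends, and each arc of \<open>F\<close> on the edge rules out one of them.
\<close>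

lemma prob_head_allowed:
  fixes e :: "nat set"
  assumes "card e = 2"
  shows "measure_pmf.prob (pmf_of_set e) {v. \<forall>u. {u, v} = e \<longrightarrow> u \<noteq> v \<longrightarrow> (u, v) \<notin> F}
    = 1 - real (card (arcs_on F e)) / 2"
proof -
  obtain x y where e: "e = {x, y}" "x \<noteq> y"
    using assms by (meson card_2_iff)
  have edges: "{u, v} = {x, y} \<longleftrightarrow> u = x \<and> v = y \<or> u = y \<and> v = x" for u v
    by (auto simp: doubleton_eq_iff)
  have arcs: "arcs_on F e = {(x, y), (y, x)} \<inter> F"
    using e(2) unfolding arcs_on_def e(1) edges by auto
  have heads: "e \<inter> {v. \<forall>u. {u, v} = e \<longrightarrow> u \<noteq> v \<longrightarrow> (u, v) \<notin> F}
    = {v \<in> {x, y}. (if v = y then (x, y) else (y, x)) \<notin> F}"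
    using e(2) unfolding e(1) edges by auto
  have "measure_pmf.prob (pmf_of_set e) {v. \<forall>u. {u, v} = e \<longrightarrow> u \<noteq> v \<longrightarrow> (u, v) \<notin> F}
     = card {v \<in> {x, y}. (if v = y then (x, y) else (y, x)) \<notin> F} / 2"
    using assms by (subst measure_pmf_of_set) (auto simp: heads[unfolded e(1)] e(1))
  also have "\<dots> = 1 - real (card (arcs_on F e)) / 2"
    using e(2) unfolding arcs card_filter_pair[OF e(2)] Int_insert_left by simp
  finally show ?thesis .
qed

lemma prob_avoids_oriented:
  assumes "E \<subseteq> possible_edges n"
  shows "measure_pmf.prob (random_orientation E) (avoids F)
    = (\<Prod>e\<in>E. 1 - real (card (arcs_on F e)) / 2)"
proof -
  define allowed where "allowed = (\<lambda>e. {v::nat. \<forall>u. {u, v} = e \<longrightarrow> u \<noteq> v \<longrightarrow> (u, v) \<notin> F})"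
  have fin: "finite E"
    using assms finite_subset by blast
  have "h \<in> orient E -` avoids F \<longleftrightarrow> h \<in> Pi E allowed" for h
  proof
    assume "h \<in> orient E -` avoids F"
    then have "(u, v) \<notin> F" if "{u, v} \<in> E" "u \<noteq> v" "h {u, v} = v" for u v
      using that unfolding avoids_def orient_def by blast
    then have "(u, h e) \<notin> F" if "e \<in> E" "{u, h e} = e" "u \<noteq> h e" for u e
      using that by metis
    then show "h \<in> Pi E allowed"
      by (simp add: Pi_def allowed_def)
  next
    assume "h \<in> Pi E allowed"
    then show "h \<in> orient E -` avoids F"
      unfolding avoids_def orient_def Pi_def allowed_def by auto
  qed
  then have "orient E -` avoids F = Pi E allowed"
    by blast
  then have "measure_pmf.prob (random_orientation E) (avoids F)
    = (\<Prod>e\<in>E. measure_pmf.prob (pmf_of_set e) (allowed e))"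
    by (simp add: random_orientation_def measure_Pi_pmf_Pi fin)
  also have "\<dots> = (\<Prod>e\<in>E. 1 - real (card (arcs_on F e)) / 2)"
    using assms unfolding allowed_def
    by (intro prod.cong refl prob_head_allowed) (auto simp: possible_edges_def)
  finally show ?thesis .
qed

lemma card_arcs_on_le:
  assumes "card e = 2"
  shows "card (arcs_on F e) \<le> 2"
proof -
  obtain x y where e: "e = {x, y}"
    using assms by (meson card_2_iff)
  have "arcs_on F e \<subseteq> {(x, y), (y, x)}"
    by (auto simp: arcs_on_def e doubleton_eq_iff)
  then have "card (arcs_on F e) \<le> card {(x, y), (y, x)}"
    by (intro card_mono) auto
  also have "\<dots> \<le> 2"
    using card_length[of "[(x, y), (y, x)]"] by simp
  finally show ?thesis .
qed

text \<open>
  Let \<open>c\<close> be the number of arcs of \<open>F\<close> on an edge. Given the graph, the orientations of its edges are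
  independent, and an edge avoids \<open>F\<close> with probability \<open>1 - c / 2\<close>. Averaging over the independent
  presence of the edges turns each factor \<open>1 - c / 2\<close> of a present edge into \<open>1 - p * c / 2\<close>.
\<close>

lemma prob_avoids:
  assumes p: "0 \<le> p" "p \<le> 1"
  shows "measure_pmf.prob (random_digraph n p) (avoids F)
    = (\<Prod>e\<in>possible_edges n. 1 - p / 2 * real (card (arcs_on F e)))"
proof -
  let ?c = "\<lambda>e. real (card (arcs_on F e))"
  have le2: "?c e \<le> 2" if "e \<in> possible_edges n" for e
    using card_arcs_on_le[of e F] that by (auto simp: possible_edges_def)
  have "measure_pmf.prob (random_digraph n p) (avoids F)
    = measure_pmf.expectation (Pi_pmf (possible_edges n) False (\<lambda>_. bernoulli_pmf p))
       (\<lambda>present. \<Prod>e | e \<in> possible_edges n \<and> present e. 1 - ?c e / 2)"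
    unfolding random_digraph_def random_graph_def prob_bind_pmf
    by (subst integral_map_pmf) (auto intro!: Bochner_Integration.integral_cong prob_avoids_oriented)
  also have "\<dots> = measure_pmf.expectation (Pi_pmf (possible_edges n) False (\<lambda>_. bernoulli_pmf p))
       (\<lambda>present. \<Prod>e\<in>possible_edges n. if present e then 1 - ?c e / 2 else 1)"
    by (intro Bochner_Integration.integral_cong refl prod.mono_neutral_cong_left) auto
  also have "\<dots> = (\<Prod>e\<in>possible_edges n. measure_pmf.expectation (bernoulli_pmf p)
       (\<lambda>b. if b then 1 - ?c e / 2 else 1))"
    using le2 by (intro expectation_prod_Pi_pmf integrable_measure_pmf_finite) auto
  also have "\<dots> = (\<Prod>e\<in>possible_edges n. 1 - p / 2 * ?c e)"
    using p by (intro prod.cong refl) (simp add: algebra_simps)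
  finally show ?thesis .
qed

lemma sum_card_arcs_on:
  assumes F: "F \<subseteq> {..<n} \<times> {..<n}" and irrefl: "\<And>x. (x, x) \<notin> F"
  shows "(\<Sum>e\<in>possible_edges n. card (arcs_on F e)) = card F"
proof -
  have fin: "finite F"
    using F finite_subset by blast
  have "card F = card (\<Union>e\<in>possible_edges n. arcs_on F e)"
  proof (intro arg_cong[where f=card] equalityI subsetI)
    fix x assume "x \<in> F"
    moreover obtain u v where x: "x = (u, v)"
      by fastforce
    ultimately have "x \<in> arcs_on F {u, v}" "{u, v} \<in> possible_edges n"
      using F irrefl[of u] by (auto simp: arcs_on_def possible_edges_def card_2_iff)
    then show "x \<in> (\<Union>e\<in>possible_edges n. arcs_on F e)"
      by blast
  qed (auto simp: arcs_on_def)
  also have "\<dots> = (\<Sum>e\<in>possible_edges n. card (arcs_on F e))"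
    by (intro card_UN_disjoint) (auto intro: finite_subset[OF _ fin] simp: arcs_on_def)
  finally show ?thesis by simp
qed

text \<open>
  An edge with both orientations forbidden contributes \<open>1 - p\<close>, which is at most the \<open>(1 - p / 2)\<^sup>2\<close> that
  two independent arcs would contribute.
\<close>

lemma prob_avoids_le:
  assumes p: "0 \<le> p" "p \<le> 1" and F: "F \<subseteq> {..<n} \<times> {..<n}" "\<And>x. (x, x) \<notin> F"
  shows "measure_pmf.prob (random_digraph n p) (avoids F) \<le> (1 - p / 2) ^ card F"
proof -
  have "(\<Prod>e\<in>possible_edges n. 1 - p / 2 * real (card (arcs_on F e)))
      \<le> (\<Prod>e\<in>possible_edges n. (1 - p / 2) ^ card (arcs_on F e))"
  proof (intro prod_mono conjI)
    fix e assume "e \<in> possible_edges n"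
    then have "card (arcs_on F e) \<le> 2"
      by (auto intro: card_arcs_on_le simp: possible_edges_def)
    then consider "card (arcs_on F e) = 0" | "card (arcs_on F e) = 1" | "card (arcs_on F e) = 2"
      by linarith
    then show "1 - p / 2 * real (card (arcs_on F e)) \<le> (1 - p / 2) ^ card (arcs_on F e)"
      by cases (auto simp: power2_eq_square algebra_simps)
    show "0 \<le> 1 - p / 2 * real (card (arcs_on F e))"
      using \<open>card _ \<le> 2\<close> p mult_mono[of "p / 2" "1 / 2" "real (card (arcs_on F e))" 2] by simp
  qed
  also have "\<dots> = (1 - p / 2) ^ card F"
    by (subst power_sum[symmetric]) (simp add: sum_card_arcs_on F)
  finally show ?thesis
    using p by (simp add: prob_avoids)
qed

lemma prob_avoids_antisymmetric:
  assumes p: "0 \<le> p" "p \<le> 1" and F: "F \<subseteq> {..<n} \<times> {..<n}"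
    and asym: "\<And>x y. (x, y) \<in> F \<Longrightarrow> (y, x) \<notin> F"
  shows "measure_pmf.prob (random_digraph n p) (avoids F) = (1 - p / 2) ^ card F"
proof -
  have irrefl: "(x, x) \<notin> F" for x
    using asym[of x x] by auto
  have "(\<Prod>e\<in>possible_edges n. 1 - p / 2 * real (card (arcs_on F e)))
      = (\<Prod>e\<in>possible_edges n. (1 - p / 2) ^ card (arcs_on F e))"
  proof (intro prod.cong refl)
    fix e :: "nat set"
    have "a = b" if a: "a \<in> arcs_on F e" and b: "b \<in> arcs_on F e" for a b
    proof -
      obtain x y where xy: "a = (x, y)" by fastforce
      obtain x' y' where xy': "b = (x', y')" by fastforce
      have "(x, y) \<in> F" "(x', y') \<in> F" "{x, y} = {x', y'}"
        using a b by (simp_all add: arcs_on_def xy xy')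
      moreover from this have "\<not> (x' = y \<and> y' = x)"
        using asym by metis
      ultimately show ?thesis
        by (auto simp: doubleton_eq_iff xy xy')
    qed
    then have "is_singleton (arcs_on F e) \<or> arcs_on F e = {}"
      by (metis is_singletonI')
    then have "card (arcs_on F e) = 1 \<or> card (arcs_on F e) = 0"
      by (auto simp: is_singleton_altdef)
    then show "1 - p / 2 * real (card (arcs_on F e)) = (1 - p / 2) ^ card (arcs_on F e)"
      by auto
  qed
  also have "\<dots> = (1 - p / 2) ^ card F"
    by (subst power_sum[symmetric]) (simp add: sum_card_arcs_on F irrefl)
  finally show ?thesis
    using p by (simp add: prob_avoids)
qed

text \<open>
  The bound \<open>(1 - p / 2) ^ (2 * n - 2)\<close> from \<open>prob_avoids_le\<close> would be of the same order as the main
  term of the joint probability, so the exact factor \<open>1 - p\<close> per pair is needed here.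
\<close>

lemma prob_isolated:
  assumes p: "0 \<le> p" "p \<le> 1" and s: "s < n"
  shows "measure_pmf.prob (random_digraph n p)
     (avoids ({s} \<times> ({..<n} - {s}) \<union> ({..<n} - {s}) \<times> {s})) = (1 - p) ^ (n - 1)"
proof -
  let ?F = "{s} \<times> ({..<n} - {s}) \<union> ({..<n} - {s}) \<times> {s}"
  let ?S = "(\<lambda>v. {s, v}) ` ({..<n} - {s})"
  have arcs: "arcs_on ?F {s, v} = {(s, v), (v, s)}" if "v < n" "v \<noteq> s" for v
  proof -
    have "{x, y} = {s, v} \<longleftrightarrow> x = s \<and> y = v \<or> x = v \<and> y = s" for x y
      by (auto simp: doubleton_eq_iff)
    then show ?thesis
      using that unfolding arcs_on_def by auto
  qed
  have "(\<Prod>e\<in>possible_edges n. 1 - p / 2 * real (card (arcs_on ?F e)))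
      = (\<Prod>e\<in>?S. 1 - p / 2 * real (card (arcs_on ?F e)))"
  proof (intro prod.mono_neutral_right ballI)
    show "?S \<subseteq> possible_edges n"
      using s by (auto simp: possible_edges_def)
    fix e assume "e \<in> possible_edges n - ?S"
    then have "arcs_on ?F e = {}"
      by (auto simp: arcs_on_def insert_commute)
    then show "1 - p / 2 * real (card (arcs_on ?F e)) = 1"
      by simp
  qed simp
  also have "\<dots> = (\<Prod>v\<in>{..<n} - {s}. 1 - p)"
    by (subst prod.reindex) (auto simp: inj_on_def doubleton_eq_iff arcs intro!: prod.cong)
  also have "\<dots> = (1 - p) ^ (n - 1)"
    using s by simp
  finally show ?thesis
    using p by (simp add: prob_avoids del: avoids_Un)
qed

lemma set_random_digraph:
  assumes "D \<in> set_pmf (random_digraph n p)"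
  shows "D \<subseteq> {..<n} \<times> {..<n}"
  using assms
  by (auto simp: random_digraph_def random_graph_def random_orientation_def orient_def
      possible_edges_def)

text \<open>
  A digraph with arcs outside \<open>{..<n} \<times> {..<n}\<close> could connect two vertices by a detour around a cut of
  \<open>{..<n}\<close>. Such digraphs have probability zero, so events are compared on the remaining ones.
\<close>

lemma prob_mono_on_support:
  assumes "\<And>D. D \<in> A \<Longrightarrow> D \<subseteq> {..<n} \<times> {..<n} \<Longrightarrow> D \<in> B"
  shows "measure_pmf.prob (random_digraph n p) A \<le> measure_pmf.prob (random_digraph n p) B"
proof -
  have "measure_pmf.prob (random_digraph n p) A
      = measure_pmf.prob (random_digraph n p) (A \<inter> set_pmf (random_digraph n p))"
    by (simp add: measure_Int_set_pmf)
  also have "\<dots> \<le> measure_pmf.prob (random_digraph n p) B"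
    using assms set_random_digraph by (intro measure_pmf.finite_measure_mono) auto
  finally show ?thesis .
qed

section \<open>Missing paths and cuts\<close>

text \<open>
  A walk can be shortened to a path: when it returns to a vertex of the path built so far, the path is cut
  there.
\<close>

lemma path_event_iff_rtrancl: "D \<in> path_event u v \<longleftrightarrow> (u, v) \<in> D\<^sup>*"
proof
  assume "D \<in> path_event u v"
  then obtain xs where xs: "directed_path D u xs v"
    by (auto simp: path_event_def)
  have "successively (\<lambda>x y. (x, y) \<in> D) xs \<Longrightarrow> xs \<noteq> [] \<Longrightarrow> (hd xs, last xs) \<in> D\<^sup>*"
    by (induction xs rule: induct_list012) (auto intro: converse_rtrancl_into_rtrancl)
  then show "(u, v) \<in> D\<^sup>*"
    using xs by (auto simp: directed_path_def)
next
  assume "(u, v) \<in> D\<^sup>*"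
  then show "D \<in> path_event u v"
  proof (induction rule: rtrancl_induct)
    case base
    then show ?case
      by (auto simp: path_event_def directed_path_def intro!: exI[of _ "[u]"])
  next
    case (step y z)
    then obtain xs where xs: "directed_path D u xs y"
      by (auto simp: path_event_def)
    show ?case
    proof (cases "z \<in> set xs")
      case True
      then obtain ys zs where "xs = ys @ z # zs"
        by (meson split_list)
      then have split: "xs = (ys @ [z]) @ zs"
        by simp
      then have "successively (\<lambda>x y. (x, y) \<in> D) (ys @ [z])"
        using xs unfolding directed_path_def by (metis successively_append_iff)
      then have "directed_path D u (ys @ [z]) z"
        using xs split by (cases ys) (auto simp: directed_path_def)
      then show ?thesis by (auto simp: path_event_def)
    next
      case False
      then have "directed_path D u (xs @ [z]) z"
        using xs step.hyps by (auto simp: directed_path_def successively_append_iff)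
      then show ?thesis by (auto simp: path_event_def)
    qed
  qed
qed

definition cut_arcs :: "nat \<Rightarrow> nat set \<Rightarrow> (nat \<times> nat) set" where
  "cut_arcs n U = U \<times> ({..<n} - U)"

text \<open>
  The set of vertices reachable from \<open>u\<close> has no arc leaving it.
\<close>

lemma no_path_imp_cut:
  assumes "D \<in> no_path_event u v" "u < n" "v < n"
  obtains U where "U \<subseteq> {..<n}" "u \<in> U" "v \<notin> U" "D \<in> avoids (cut_arcs n U)"
proof
  let ?U = "D\<^sup>* `` {u} \<inter> {..<n}"
  show "?U \<subseteq> {..<n}" "u \<in> ?U" "v \<notin> ?U"
    using assms by (auto simp: no_path_event_def path_event_iff_rtrancl)
  show "D \<in> avoids (cut_arcs n ?U)"
    by (auto simp: avoids_def cut_arcs_def intro: rtrancl_into_rtrancl)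
qed

lemma cut_imp_no_path:
  assumes "D \<in> avoids (cut_arcs n U)" "D \<subseteq> {..<n} \<times> {..<n}" "u \<in> U" "v \<notin> U"
  shows "D \<in> no_path_event u v"
proof -
  have "w \<in> U" if "(u, w) \<in> D\<^sup>*" for w
    using that
  proof (induction rule: rtrancl_induct)
    case (step y z)
    then show ?case
      using assms(1,2) by (auto simp: avoids_def cut_arcs_def)
  qed (fact assms(3))
  then show ?thesis
    using assms(4) by (auto simp: no_path_event_def path_event_iff_rtrancl)
qed

text \<open>
  Nested sets never forbid both orientations of a pair, so the probability is exact. The exponent counts
  the arcs out of \<open>U\<close> and the remaining ones, from \<open>V - U\<close> to the complement of \<open>V\<close>. All three main
  configurations of the joint event have this form; for instance \<open>U = {a}\<close> and \<open>V = {a, s}\<close> express that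
  \<open>a\<close> has no out-arc and \<open>s\<close> none except possibly to \<open>a\<close>.
\<close>

lemma prob_nested_cuts:
  assumes p: "0 \<le> p" "p \<le> 1" and UV: "U \<subseteq> V" "V \<subseteq> {..<n}"
  shows "measure_pmf.prob (random_digraph n p) (avoids (cut_arcs n U \<union> cut_arcs n V))
    = (1 - p / 2) ^ (card U * (n - card U) + (card V - card U) * (n - card V))"
proof -
  have fin: "finite U" "finite V"
    using UV by (auto intro: finite_subset[OF _ finite_lessThan])
  have split: "cut_arcs n U \<union> cut_arcs n V = U \<times> ({..<n} - U) \<union> (V - U) \<times> ({..<n} - V)"
    using UV by (auto simp: cut_arcs_def)
  have "card (cut_arcs n U \<union> cut_arcs n V)
      = card (U \<times> ({..<n} - U)) + card ((V - U) \<times> ({..<n} - V))"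
    unfolding split using fin by (intro card_Un_disjoint) auto
  also have "\<dots> = card U * (n - card U) + (card V - card U) * (n - card V)"
    using UV fin by (simp add: card_cartesian_product card_Diff_subset)
  finally have "card (cut_arcs n U \<union> cut_arcs n V)
      = card U * (n - card U) + (card V - card U) * (n - card V)" .
  moreover have "measure_pmf.prob (random_digraph n p) (avoids (cut_arcs n U \<union> cut_arcs n V))
      = (1 - p / 2) ^ card (cut_arcs n U \<union> cut_arcs n V)"
    using UV by (intro prob_avoids_antisymmetric p) (auto simp: cut_arcs_def)
  ultimately show ?thesis by simp
qed

lemma prob_cut:
  assumes "0 \<le> p" "p \<le> 1" "U \<subseteq> {..<n}"
  shows "measure_pmf.prob (random_digraph n p) (avoids (cut_arcs n U))
    = (1 - p / 2) ^ (card U * (n - card U))"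
  using prob_nested_cuts[of p U U n] assms by simp

section \<open>Negligibility of cuts with two large sides\<close>

text \<open>
  A union bound for the existence of a set without leaving arcs among those of size between \<open>m\<close> and \<open>n - m\<close>.
\<close>

definition large_separations :: "nat \<Rightarrow> nat \<Rightarrow> real \<Rightarrow> real" where
  "large_separations m n q = (\<Sum>k=m..n-m. real (n choose k) * q ^ (k * (n - k)))"

lemma mult_complement_mono:
  fixes k m n :: nat
  assumes "m \<le> k" "k \<le> n - m" "m \<le> n"
  shows "m * (n - m) \<le> k * (n - k)"
proof -
  obtain i where i: "k = m + i"
    using assms(1) le_Suc_ex by blast
  obtain j where j: "n = k + (m + j)"
    using le_Suc_ex[of "k + m" n] assms unfolding add.assoc by fastforce
  have "n - m = m + i + j" "n - k = m + j"
    using i j by auto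
  then show ?thesis
    by (simp add: i algebra_simps)
qed

lemma square_complement:
  fixes m n :: nat
  shows "m \<le> n \<Longrightarrow> m * (n - m) + m * m = m * n"
  by (simp flip: add_mult_distrib2)

lemma power_times_geometric_tendsto_0:
  fixes x :: real
  assumes "0 \<le> x" "x < 1"
  shows "(\<lambda>n. real n ^ k * x ^ n) \<longlonglongrightarrow> 0"
proof (cases "k = 0")
  case True
  then show ?thesis
    using assms by (simp add: LIMSEQ_power_zero)
next
  case False
  define y where "y = root k x"
  have y: "0 \<le> y" "y < 1" "y ^ k = x"
    using assms False by (auto simp: y_def)
  have "(\<lambda>n. (real n * y ^ n) ^ k) \<longlonglongrightarrow> 0 ^ k"
    using y by (intro tendsto_power powser_times_n_limit_0) auto
  also have "(\<lambda>n. (real n * y ^ n) ^ k) = (\<lambda>n. real n ^ k * x ^ n)"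
    by (simp add: power_mult_distrib flip: y(3) power_mult) (simp add: mult.commute)
  finally show ?thesis
    using False by (simp add: power_0_left)
qed

text \<open>
  A free parameter \<open>K\<close> splits the range. If one side has fewer than \<open>K\<close> vertices, there are only
  polynomially many choices and at least \<open>m * (n - m)\<close> forbidden arcs; if both sides have at least \<open>K\<close>,
  the crude count \<open>2 ^ n\<close> is beaten by the \<open>K * (n - K)\<close> forbidden arcs once \<open>K\<close> is large.
\<close>

lemma separation_term_le:
  fixes q :: real
  assumes q: "0 < q" "q \<le> 1" and k: "m \<le> k" "k \<le> n - m" "m \<le> n" and "0 < n"
  shows "real (n choose k) * q ^ (k * (n - k))
    \<le> real n ^ K * q ^ (m * (n - m)) + 2 ^ n * q ^ (K * (n - K))"
proof (cases "K \<le> k \<and> k \<le> n - K \<and> K \<le> n")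
  case True
  then have "q ^ (k * (n - k)) \<le> q ^ (K * (n - K))"
    using q by (intro power_decreasing mult_complement_mono) auto
  moreover have "real (n choose k) \<le> 2 ^ n"
    using binomial_le_pow2[of n k] by (metis of_nat_le_iff of_nat_numeral of_nat_power)
  ultimately have "real (n choose k) * q ^ (k * (n - k)) \<le> 2 ^ n * q ^ (K * (n - K))"
    using q by (intro mult_mono) auto
  then show ?thesis
    using q by (simp add: add_increasing)
next
  case False
  have kn: "k \<le> n" using k by linarith
  have "n choose k \<le> n ^ K"
  proof (cases "k \<le> K")
    case True
    have "n choose k \<le> n ^ k"
      by (rule binomial_le_pow) fact
    also have "\<dots> \<le> n ^ K"
      using True \<open>0 < n\<close> by (intro power_increasing) auto
    finally show ?thesis .
  next
    case k_large: False
    have "n choose k = n choose (n - k)"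
      by (rule binomial_symmetric) fact
    also have "\<dots> \<le> n ^ (n - k)"
      by (rule binomial_le_pow) simp
    also have "\<dots> \<le> n ^ K"
      using False k_large kn \<open>0 < n\<close> by (intro power_increasing) linarith+
    finally show ?thesis .
  qed
  then have "real (n choose k) \<le> real n ^ K"
    by (metis of_nat_le_iff of_nat_power)
  moreover have "q ^ (k * (n - k)) \<le> q ^ (m * (n - m))"
    using q k by (intro power_decreasing mult_complement_mono) auto
  ultimately have "real (n choose k) * q ^ (k * (n - k)) \<le> real n ^ K * q ^ (m * (n - m))"
    using q by (intro mult_mono) auto
  then show ?thesis
    using q by (simp add: add_increasing2)
qed

text \<open>
  The sum is of order \<open>q ^ ((m + 1) * n)\<close> up to a polynomial factor, so one factor \<open>q ^ n\<close> is left over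
  after the division.
\<close>

lemma large_separations_negligible:
  fixes q :: real
  assumes q: "0 < q" "q < 1"
  shows "(\<lambda>n. large_separations (Suc m) n q / (q ^ m) ^ n) \<longlonglongrightarrow> 0"
proof -
  obtain j where j: "q ^ j < 1 / 2"
    using real_arch_pow_inv[of "1 / 2" q] q by auto
  \<comment> \<open>The exponent \<open>K\<close> must pay for the count \<open>2 ^ n\<close> and for the division by \<open>(q ^ m) ^ n\<close>.\<close>
  define K where "K = j + m"
  let ?M = "Suc m"
  let ?u = "\<lambda>n. (real n + 1) * (real n ^ K * q ^ n) / q ^ (?M * ?M)
     + (real n + 1) * (2 * q ^ j) ^ n / q ^ (K * K)"
  have "?u \<longlonglongrightarrow> 0"
  proof -
    have "(\<lambda>n. (real n ^ (K + 1) * q ^ n + real n ^ K * q ^ n) / q ^ (?M * ?M)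
       + (real n ^ 1 * (2 * q ^ j) ^ n + real n ^ 0 * (2 * q ^ j) ^ n) / q ^ (K * K))
       \<longlonglongrightarrow> (0 + 0) / q ^ (?M * ?M) + (0 + 0) / q ^ (K * K)"
      using q j by (intro tendsto_intros power_times_geometric_tendsto_0) auto
    then show ?thesis
      by (simp add: algebra_simps)
  qed
  moreover have "\<forall>\<^sub>F n in sequentially. norm (large_separations ?M n q / (q ^ m) ^ n) \<le> ?u n"
    using eventually_ge_at_top[of "?M + K + 1"]
  proof eventually_elim
    case (elim n)
    let ?t = "real n ^ K * q ^ (?M * (n - ?M)) + 2 ^ n * q ^ (K * (n - K))"
    have t: "0 \<le> ?t"
      using q by simp
    have "large_separations ?M n q \<le> (\<Sum>k=?M..n-?M. ?t)"
      unfolding large_separations_def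
      using q elim by (intro sum_mono separation_term_le) auto
    also have "\<dots> = real (card {?M..n-?M}) * ?t"
      by simp
    also have "\<dots> \<le> (real n + 1) * ?t"
      using t elim by (intro mult_right_mono) auto
    finally have "large_separations ?M n q / (q ^ m) ^ n \<le> (real n + 1) * ?t / (q ^ m) ^ n"
      using q by (intro divide_right_mono) auto
    also have "\<dots> = ?u n"
    proof -
      have "q ^ (?M * (n - ?M)) = q ^ n * (q ^ m) ^ n / q ^ (?M * ?M)"
      proof -
        have "?M * (n - ?M) + ?M * ?M = n + m * n"
          using square_complement[of ?M n] elim by simp
        then have "q ^ (?M * (n - ?M)) * q ^ (?M * ?M) = q ^ n * (q ^ m) ^ n"
          by (simp only: power_add[symmetric] power_mult[symmetric])
        then show ?thesis
          using q by (simp add: field_simps)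
      qed
      moreover have "q ^ (K * (n - K)) = (q ^ j) ^ n * (q ^ m) ^ n / q ^ (K * K)"
      proof -
        have "K * (n - K) + K * K = j * n + m * n"
          using square_complement[of K n] elim by (simp add: K_def add_mult_distrib)
        then have "q ^ (K * (n - K)) * q ^ (K * K) = (q ^ j) ^ n * (q ^ m) ^ n"
          by (simp only: power_add[symmetric] power_mult[symmetric])
        then show ?thesis
          using q by (simp add: field_simps)
      qed
      ultimately have "?t / (q ^ m) ^ n
          = real n ^ K * q ^ n / q ^ (?M * ?M) + (2 * q ^ j) ^ n / q ^ (K * K)"
        using q by (simp add: add_divide_distrib power_mult_distrib)
      then show ?thesis
        by (metis (no_types, lifting) distrib_left times_divide_eq_right)
    qed
    finally have "large_separations ?M n q / (q ^ m) ^ n \<le> ?u n" .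
    moreover have "0 \<le> large_separations ?M n q / (q ^ m) ^ n"
      using q by (simp add: large_separations_def sum_nonneg)
    ultimately show ?case
      by simp
  qed
  ultimately show ?thesis
    by (rule Lim_null_comparison[rotated])
qed

section \<open>The ways in which both paths can be missing\<close>

definition large_cut_event :: "nat \<Rightarrow> nat \<Rightarrow> (nat \<times> nat) set set" where
  "large_cut_event m n = (\<Union>U\<in>{U. U \<subseteq> {..<n} \<and> card U \<in> {m..n - m}}. avoids (cut_arcs n U))"

lemma prob_large_cut_event:
  assumes p: "0 \<le> p" "p \<le> 1"
  shows "measure_pmf.prob (random_digraph n p) (large_cut_event m n)
    \<le> large_separations m n (1 - p / 2)"
proof -
  let ?S = "{U. U \<subseteq> {..<n} \<and> card U \<in> {m..n - m}}"
  let ?q = "1 - p / 2"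
  have fin: "finite ?S"
    by (rule finite_subset[of _ "Pow {..<n}"]) auto
  have "measure_pmf.prob (random_digraph n p) (large_cut_event m n)
      \<le> (\<Sum>U\<in>?S. measure_pmf.prob (random_digraph n p) (avoids (cut_arcs n U)))"
    unfolding large_cut_event_def using fin by (intro measure_pmf.finite_measure_subadditive_finite) auto
  also have "\<dots> = (\<Sum>U\<in>?S. ?q ^ (card U * (n - card U)))"
    using p by (intro sum.cong refl prob_cut) auto
  also have "\<dots> = (\<Sum>k=m..n-m. \<Sum>U | U \<in> ?S \<and> card U = k. ?q ^ (card U * (n - card U)))"
    using fin by (intro sum.group[symmetric]) auto
  also have "\<dots> = large_separations m n ?q"
    unfolding large_separations_def
  proof (intro sum.cong refl)
    fix k assume "k \<in> {m..n - m}"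
    then have "{U \<in> ?S. card U = k} = {U. U \<subseteq> {..<n} \<and> card U = k}"
      by auto
    then show "(\<Sum>U | U \<in> ?S \<and> card U = k. ?q ^ (card U * (n - card U)))
        = real (n choose k) * ?q ^ (k * (n - k))"
      by (simp add: n_subsets)
  qed
  finally show ?thesis .
qed

text \<open>
  Here \<open>W\<close> is a bounded set of exceptional vertices, \<open>X\<close> consists of vertices without arcs to the outside
  of \<open>W\<close>, and \<open>Y\<close> of vertices without arcs from there. Arcs inside \<open>W\<close> are ignored, which makes the
  number of forbidden arcs easy to count while costing only a constant factor. A vertex in both \<open>X\<close> and
  \<open>Y\<close> counts twice.
\<close>

definition crowded_event :: "nat \<Rightarrow> nat set \<Rightarrow> (nat \<times> nat) set set" where
  "crowded_event n W = (\<Union>(X, Y)\<in>{(X, Y). X \<subseteq> W \<and> Y \<subseteq> W \<and> 3 \<le> card X + card Y}.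
     avoids (X \<times> ({..<n} - W) \<union> ({..<n} - W) \<times> Y))"

text \<open>
  There are at most \<open>(2 ^ 5)\<^sup>2 = 1024\<close> choices of \<open>X\<close> and \<open>Y\<close>, each forbidding three arcs for every one of
  the at least \<open>n - 5\<close> vertices outside \<open>W\<close>. Five vertices are what \<open>no_paths_cases\<close> needs:
  \<open>a\<close>, \<open>b\<close>, \<open>s\<close> and one additional vertex for each of the two separating sets.
\<close>

lemma prob_crowded_event:
  assumes p: "0 \<le> p" "p \<le> 1" and W: "W \<subseteq> {..<n}" "card W \<le> 5"
  shows "measure_pmf.prob (random_digraph n p) (crowded_event n W)
    \<le> 1024 * (1 - p / 2) ^ (3 * (n - 5))"
proof -
  let ?S = "{(X, Y). X \<subseteq> W \<and> Y \<subseteq> W \<and> 3 \<le> card X + card Y}"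
  let ?F = "\<lambda>(X, Y). X \<times> ({..<n} - W) \<union> ({..<n} - W) \<times> Y"
  let ?q = "1 - p / 2"
  have finW: "finite W"
    using W by (auto intro: finite_subset[OF _ finite_lessThan])
  have sub: "?S \<subseteq> Pow W \<times> Pow W"
    by auto
  then have fin: "finite ?S"
    by (rule finite_subset) (use finW in auto)
  have "card ?S \<le> card (Pow W \<times> Pow W)"
    using sub finW by (intro card_mono) auto
  also have "\<dots> = 4 ^ card W"
    using finW by (simp add: card_cartesian_product card_Pow flip: power_mult_distrib)
  also have "\<dots> \<le> 4 ^ 5"
    using W by (intro power_increasing) auto
  finally have card: "real (card ?S) \<le> 1024"
    by simp
  have each: "measure_pmf.prob (random_digraph n p) (avoids (?F XY)) \<le> ?q ^ (3 * (n - 5))"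
    if member: "XY \<in> ?S" for XY
  proof -
    obtain X Y where XY: "XY = (X, Y)" "X \<subseteq> W" "Y \<subseteq> W" "3 \<le> card X + card Y"
      using member by auto
    have finXY: "finite X" "finite Y"
      using XY by (auto intro: finite_subset[OF _ finW])
    have "card (?F XY) = card (X \<times> ({..<n} - W)) + card (({..<n} - W) \<times> Y)"
      unfolding XY prod.case using XY finXY by (intro card_Un_disjoint) auto
    also have "\<dots> = (card X + card Y) * (n - card W)"
      using W finW by (simp add: card_cartesian_product card_Diff_subset algebra_simps)
    also have "\<dots> \<ge> 3 * (n - 5)"
      using XY W by (intro mult_mono) auto
    finally have "3 * (n - 5) \<le> card (?F XY)" .
    moreover have "measure_pmf.prob (random_digraph n p) (avoids (?F XY)) \<le> ?q ^ card (?F XY)"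
      using XY W p by (intro prob_avoids_le) auto
    ultimately show ?thesis
      using p by (elim order_trans) (intro power_decreasing, auto)
  qed
  have "measure_pmf.prob (random_digraph n p) (crowded_event n W)
      \<le> (\<Sum>XY\<in>?S. measure_pmf.prob (random_digraph n p) (avoids (?F XY)))"
    unfolding crowded_event_def case_prod_beta'
    using fin by (intro measure_pmf.finite_measure_subadditive_finite) (auto simp: case_prod_beta')
  also have "\<dots> \<le> (\<Sum>XY\<in>?S. ?q ^ (3 * (n - 5)))"
    by (intro sum_mono each)
  also have "\<dots> \<le> 1024 * ?q ^ (3 * (n - 5))"
    using card p by (simp add: mult_right_mono)
  finally show ?thesis .
qed

lemma crowded_eventI:
  assumes "D \<in> avoids (X \<times> ({..<n} - W))" "D \<in> avoids (({..<n} - W) \<times> Y)"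
    and "X \<subseteq> W" "Y \<subseteq> W" "3 \<le> card X + card Y"
  shows "D \<in> crowded_event n W"
  using assms by (auto simp: crowded_event_def)

lemma card_le_2_subset:
  assumes "finite T" "card T \<le> 2" "t \<in> T"
  obtains x where "x \<in> T" "T \<subseteq> {t, x}"
proof (cases "T = {t}")
  case True
  then show ?thesis using that by blast
next
  case False
  then obtain x where x: "x \<in> T" "x \<noteq> t"
    using assms by blast
  have "T = {t, x}"
    using assms x by (intro card_seteq[symmetric]) auto
  then show ?thesis using that x by blast
qed

text \<open>
  The small side of the separating set \<open>U\<close> contains \<open>u\<close> or \<open>v\<close>, hence at most one further vertex.
\<close>

lemma cut_cases:
  assumes U: "U \<subseteq> {..<n}" "u \<in> U" "v \<notin> U" and "u < n" "v < n"
    and D: "D \<in> avoids (cut_arcs n U)" "D \<notin> large_cut_event 3 n"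
  obtains (small) x where "x < n" "U \<subseteq> {u, x}"
  | (cosmall) x where "x < n" "{..<n} - U \<subseteq> {v, x}"
proof -
  have fin: "finite U"
    using U by (auto intro: finite_subset[OF _ finite_lessThan])
  have "card U \<notin> {3..n - 3}"
    using U D by (auto simp: large_cut_event_def)
  moreover have "card ({..<n} - U) = n - card U"
    using U fin by (simp add: card_Diff_subset)
  ultimately consider "card U \<le> 2" | "card ({..<n} - U) \<le> 2"
    by fastforce
  then show thesis
  proof cases
    case 1
    then obtain x where "x \<in> U" "U \<subseteq> {u, x}"
      using fin U by (metis card_le_2_subset)
    then show thesis using small U by blast
  next
    case 2
    moreover have "v \<in> {..<n} - U"
      using assms by auto
    ultimately obtain x where "x \<in> {..<n} - U" "{..<n} - U \<subseteq> {v, x}"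
      by (metis card_le_2_subset finite_Diff finite_lessThan)
    then show thesis using cosmall by blast
  qed
qed

lemma cut_avoids_from:
  "\<lbrakk>D \<in> avoids (cut_arcs n U); U \<subseteq> W\<rbrakk> \<Longrightarrow> D \<in> avoids (U \<times> ({..<n} - W))"
  by (auto simp: avoids_def cut_arcs_def)

lemma cut_avoids_to:
  "\<lbrakk>D \<in> avoids (cut_arcs n U); {..<n} - U \<subseteq> W\<rbrakk> \<Longrightarrow> D \<in> avoids (({..<n} - W) \<times> ({..<n} - U))"
  by (auto simp: avoids_def cut_arcs_def)

lemma card_lt_3_pair:
  assumes "\<not> 3 \<le> card T" "finite T" "x \<in> T" "y \<in> T" "x \<noteq> y"
  shows "T = {x, y}"
proof -
  have "{x, y} = T"
    using assms by (intro card_seteq) auto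
  then show ?thesis by simp
qed

lemma card_lt_3_singletons:
  assumes "\<not> 3 \<le> card S + card T" "finite S" "finite T" "x \<in> S" "y \<in> T"
  shows "S = {x}" "T = {y}"
proof -
  have "card S > 0" "card T > 0"
    using assms by (auto simp: card_gt_0_iff)
  then have "card S = 1" "card T = 1"
    using assms(1) by linarith+
  then show "S = {x}" "T = {y}"
    using assms by (auto simp: card_1_singleton_iff)
qed

text \<open>
  Let \<open>U\<close> and \<open>V\<close> witness \<open>a \<not>\<rightarrow> s\<close> and \<open>s \<not>\<rightarrow> b\<close>. Outside the large cut event, each
  has a side of at most two vertices, which gives four cases. The small sides forbid arcs out of \<open>U\<close> or
  \<open>V\<close>, and into their complements. If this involves three or more vertices, a crowded event occurs;
  otherwise the small sides are forced up to the choice explained below, and the four cases are the four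
  configurations. When the two small sides point in the same direction, one may contain the
  distinguished vertex of the other: \<open>V = {a, s}\<close> is possible with \<open>U = {a}\<close>, which is why \<open>s\<close> may
  keep its arc to \<open>a\<close>, and dually for the arc from \<open>b\<close> to \<open>s\<close>.
\<close>

lemma no_paths_cases:
  assumes vertices: "a < n" "b < n" "s < n" and distinct: "a \<noteq> b" "a \<noteq> s" "b \<noteq> s"
    and D: "D \<in> no_path_event a s" "D \<in> no_path_event s b"
  shows "D \<in> avoids (cut_arcs n {a} \<union> cut_arcs n {a, s})
    \<union> avoids (cut_arcs n {a} \<union> cut_arcs n ({..<n} - {b}))
    \<union> avoids (cut_arcs n ({..<n} - {b, s}) \<union> cut_arcs n ({..<n} - {b}))
    \<union> avoids (cut_arcs n {s} \<union> cut_arcs n ({..<n} - {s}))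
    \<union> large_cut_event 3 n
    \<union> (\<Union>(x, y)\<in>{..<n} \<times> {..<n}. crowded_event n {a, b, s, x, y})" (is "D \<in> ?R")
proof (rule ccontr)
  assume contra: "D \<notin> ?R"
  obtain U where U: "U \<subseteq> {..<n}" "a \<in> U" "s \<notin> U" "D \<in> avoids (cut_arcs n U)"
    using no_path_imp_cut D(1) vertices by metis
  obtain V where V: "V \<subseteq> {..<n}" "s \<in> V" "b \<notin> V" "D \<in> avoids (cut_arcs n V)"
    using no_path_imp_cut D(2) vertices by metis
  have fin: "finite U" "finite V"
    using U V by (auto intro: finite_subset[OF _ finite_lessThan])
  have large: "D \<notin> large_cut_event 3 n"
    using contra by auto
  have crowded: "D \<notin> crowded_event n {a, b, s, x, y}" if "x < n" "y < n" for x y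
    using contra that by auto
  have U_compl: "U = {..<n} - T" if "{..<n} - U = T" for T
    using U that by auto
  have V_compl: "V = {..<n} - T" if "{..<n} - V = T" for T
    using V that by auto
  show False
    using U(1-3) vertices(1,3) U(4) large
  proof (cases rule: cut_cases)
    case (small x)
    note x = this
    show False
      using V(1-3) vertices(3,2) V(4) large
    proof (cases rule: cut_cases)
      case (small y)
      let ?W = "{a, b, s, x, y}"
      have "D \<in> avoids ((U \<union> V) \<times> ({..<n} - ?W))"
        using cut_avoids_from[OF U(4), of ?W] cut_avoids_from[OF V(4), of ?W] x small
        by (auto simp: Sigma_Un_distrib1)
      then have "\<not> 3 \<le> card (U \<union> V) + card ({} :: nat set)"
        using crowded_eventI[of D "U \<union> V" n ?W "{}"] crowded[of x y] x small
        by (auto simp: avoids_def)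
      then have "U \<union> V = {a, s}"
        using U V fin distinct by (intro card_lt_3_pair) auto
      then have "U = {a}" "V = {s} \<or> V = {a, s}"
        using U V by auto
      then have "D \<in> avoids (cut_arcs n {a} \<union> cut_arcs n {a, s})"
        using U V by (auto simp: avoids_def cut_arcs_def)
      then show False
        using contra by blast
    next
      case (cosmall y)
      let ?W = "{a, b, s, x, y}"
      have "\<not> 3 \<le> card U + card ({..<n} - V)"
        using crowded_eventI[of D U n ?W "{..<n} - V"] crowded[of x y] x cosmall
          cut_avoids_from[OF U(4), of ?W] cut_avoids_to[OF V(4), of ?W] by blast
      then have "U = {a}" "{..<n} - V = {b}"
        using card_lt_3_singletons[of U "{..<n} - V" a b] U V vertices fin by auto
      then have "D \<in> avoids (cut_arcs n {a} \<union> cut_arcs n ({..<n} - {b}))"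
        using U V V_compl[of "{b}"] by auto
      then show False
        using contra by blast
    qed
  next
    case (cosmall x)
    note x = this
    show False
      using V(1-3) vertices(3,2) V(4) large
    proof (cases rule: cut_cases)
      case (small y)
      let ?W = "{a, b, s, x, y}"
      have "\<not> 3 \<le> card V + card ({..<n} - U)"
        using crowded_eventI[of D V n ?W "{..<n} - U"] crowded[of x y] x small
          cut_avoids_from[OF V(4), of ?W] cut_avoids_to[OF U(4), of ?W] by blast
      then have "V = {s}" "{..<n} - U = {s}"
        using card_lt_3_singletons[of V "{..<n} - U" s s] U V vertices fin by auto
      then have "D \<in> avoids (cut_arcs n {s} \<union> cut_arcs n ({..<n} - {s}))"
        using U V U_compl[of "{s}"] by auto
      then show False
        using contra by blast
    next
      case (cosmall y)
      let ?W = "{a, b, s, x, y}"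
      let ?Y = "({..<n} - U) \<union> ({..<n} - V)"
      have "D \<in> avoids (({..<n} - ?W) \<times> ?Y)"
        using cut_avoids_to[OF U(4), of ?W] cut_avoids_to[OF V(4), of ?W] x cosmall
        by (auto simp: Sigma_Un_distrib2)
      then have "\<not> 3 \<le> card ({} :: nat set) + card ?Y"
        using crowded_eventI[of D "{}" n ?W ?Y] crowded[of x y] x cosmall
        by (auto simp: avoids_def)
      then have "?Y = {b, s}"
        using U V distinct vertices by (intro card_lt_3_pair) auto
      then have "{..<n} - V = {b}" "{..<n} - U = {s} \<or> {..<n} - U = {b, s}"
        using U V vertices by auto
      then have "V = {..<n} - {b}" "U = {..<n} - {s} \<or> U = {..<n} - {b, s}"
        using U_compl[of "{s}"] U_compl[of "{b, s}"] V_compl[of "{b}"] by blast+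
      then have "D \<in> avoids (cut_arcs n ({..<n} - {b, s}) \<union> cut_arcs n ({..<n} - {b}))"
        using U V by (auto simp: avoids_def cut_arcs_def)
      then show False
        using contra by blast
    qed
  qed
qed

section \<open>Probability bounds\<close>

lemma prob_inclusion_exclusion_2:
  "measure_pmf.prob M A + measure_pmf.prob M B
    = measure_pmf.prob M (A \<union> B) + measure_pmf.prob M (A \<inter> B)"
  using measure_pmf.finite_measure_Union'[of A M B] measure_pmf.finite_measure_Diff'[of B M A]
  by (simp add: Int_commute)

lemma prob_bonferroni_3:
  "measure_pmf.prob M A + measure_pmf.prob M B + measure_pmf.prob M C
    \<le> measure_pmf.prob M (A \<union> B \<union> C) + measure_pmf.prob M (A \<inter> B)
      + measure_pmf.prob M (A \<inter> C) + measure_pmf.prob M (B \<inter> C)"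
proof -
  have "measure_pmf.prob M ((A \<union> B) \<inter> C) \<le> measure_pmf.prob M (A \<inter> C) + measure_pmf.prob M (B \<inter> C)"
    unfolding Int_Un_distrib2 by (intro measure_Un_le) auto
  then show ?thesis
    using prob_inclusion_exclusion_2[of M A B] prob_inclusion_exclusion_2[of M "A \<union> B" C]
    by linarith
qed

lemma prob_Un_le:
  "measure_pmf.prob M (A \<union> B) \<le> measure_pmf.prob M A + measure_pmf.prob M B"
  by (intro measure_Un_le) auto

text \<open>
  The main events are that \<open>u\<close> has no out-arc and that \<open>v\<close> has no in-arc; the last error term bounds the
  probability of their intersection.
\<close>

lemma prob_no_path_bounds:
  assumes p: "0 \<le> p" "p \<le> 1" and uv: "u < n" "v < n" "u \<noteq> v"
  defines "q \<equiv> 1 - p / 2"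
  shows "\<bar>measure_pmf.prob (random_digraph n p) (no_path_event u v) - 2 * q ^ (n - 1)\<bar>
    \<le> large_separations 2 n q + q ^ (2 * (n - 2))"
proof -
  let ?P = "measure_pmf.prob (random_digraph n p)"
  let ?A = "avoids (cut_arcs n {u})" and ?B = "avoids (cut_arcs n ({..<n} - {v}))"
  have n: "2 \<le> n"
    using uv by linarith
  have A: "?P ?A = q ^ (n - 1)"
    using p uv by (simp add: prob_cut q_def)
  have B: "?P ?B = q ^ (n - 1)"
    using p uv n by (simp add: prob_cut q_def card_Diff_subset)
  have "no_path_event u v \<subseteq> ?A \<union> ?B \<union> large_cut_event 2 n"
  proof
    fix D assume "D \<in> no_path_event u v"
    then obtain U where U: "U \<subseteq> {..<n}" "u \<in> U" "v \<notin> U" "D \<in> avoids (cut_arcs n U)"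
      using no_path_imp_cut uv by metis
    have fin: "finite U"
      using U by (auto intro: finite_subset[OF _ finite_lessThan])
    have compl: "card ({..<n} - U) = n - card U"
      using U fin by (simp add: card_Diff_subset)
    have "card U > 0"
      using U fin by (auto simp: card_gt_0_iff)
    then consider "card U \<in> {2..n - 2}" | "card U = 1" | "card ({..<n} - U) \<le> 1"
      unfolding compl by fastforce
    then show "D \<in> ?A \<union> ?B \<union> large_cut_event 2 n"
    proof cases
      case 1
      then show ?thesis
        using U by (auto simp: large_cut_event_def)
    next
      case 2
      then have "U = {u}"
        using U by (auto simp: card_1_singleton_iff)
      then show ?thesis
        using U by auto
    next
      case 3
      have "{v} = {..<n} - U"
        using 3 U uv by (intro card_seteq) auto
      then have "U = {..<n} - {v}"
        using U by auto
      then show ?thesis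
        using U by auto
    qed
  qed
  then have "?P (no_path_event u v) \<le> ?P (?A \<union> ?B \<union> large_cut_event 2 n)"
    by (intro measure_pmf.finite_measure_mono) auto
  also have "\<dots> \<le> ?P ?A + ?P ?B + ?P (large_cut_event 2 n)"
    using prob_Un_le[of "random_digraph n p" "?A \<union> ?B" "large_cut_event 2 n"]
      prob_Un_le[of "random_digraph n p" ?A ?B] by linarith
  also have "\<dots> \<le> 2 * q ^ (n - 1) + large_separations 2 n q"
    using prob_large_cut_event[OF p, of n 2] by (simp add: A B q_def)
  finally have upper: "?P (no_path_event u v) \<le> 2 * q ^ (n - 1) + large_separations 2 n q" .
  have "?P (?A \<inter> ?B) = q ^ (1 * (n - 1) + (n - 1 - 1) * (n - (n - 1)))"
    using prob_nested_cuts[OF p, of "{u}" "{..<n} - {v}" n] uv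
    by (simp add: q_def card_Diff_subset)
  also have "1 * (n - 1) + (n - 1 - 1) * (n - (n - 1)) = 2 * n - 3"
    using n by simp
  also have "q ^ (2 * n - 3) \<le> q ^ (2 * (n - 2))"
    using p by (intro power_decreasing) (auto simp: q_def)
  finally have AB: "?P (?A \<inter> ?B) \<le> q ^ (2 * (n - 2))" .
  have "?P (?A \<union> ?B) \<le> ?P (no_path_event u v)"
    using uv by (intro prob_mono_on_support) (auto dest: cut_imp_no_path)
  then have "2 * q ^ (n - 1) - q ^ (2 * (n - 2)) \<le> ?P (no_path_event u v)"
    using prob_inclusion_exclusion_2[of "random_digraph n p" ?A ?B] AB by (simp add: A B)
  moreover have "0 \<le> large_separations 2 n q" "0 \<le> q ^ (2 * (n - 2))"
    using p by (auto simp: large_separations_def q_def intro!: sum_nonneg)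
  ultimately show ?thesis
    using upper by linarith
qed

text \<open>
  Upper bound: the union bound over \<open>no_paths_cases\<close>. Lower bound: inclusion-exclusion for the three main
  configurations, where any two together bring three vertices into a crowded event. The factor
  \<open>n\<^sup>2 + 3\<close> collects the \<open>n\<^sup>2\<close> crowded events of the upper bound and the three overlaps.
\<close>

lemma prob_no_paths_bounds:
  assumes p: "0 \<le> p" "p \<le> 1"
    and vertices: "a < n" "b < n" "s < n" and distinct: "a \<noteq> b" "a \<noteq> s" "b \<noteq> s"
  defines "q \<equiv> 1 - p / 2"
  shows "\<bar>measure_pmf.prob (random_digraph n p) (no_path_event a s \<inter> no_path_event s b)
      - 3 * q ^ (2 * n - 3)\<bar>
    \<le> (1 - p) ^ (n - 1) + large_separations 3 n q + 1024 * (real n ^ 2 + 3) * q ^ (3 * (n - 5))"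
proof -
  let ?P = "measure_pmf.prob (random_digraph n p)"
  let ?E = "no_path_event a s \<inter> no_path_event s b"
  let ?A = "avoids (cut_arcs n {a} \<union> cut_arcs n {a, s})"
  let ?B = "avoids (cut_arcs n {a} \<union> cut_arcs n ({..<n} - {b}))"
  let ?C = "avoids (cut_arcs n ({..<n} - {b, s}) \<union> cut_arcs n ({..<n} - {b}))"
  let ?I = "avoids (cut_arcs n {s} \<union> cut_arcs n ({..<n} - {s}))"
  let ?K = "\<Union>(x, y)\<in>{..<n} \<times> {..<n}. crowded_event n {a, b, s, x, y}"
  let ?k = "1024 * q ^ (3 * (n - 5))"
  have n: "3 \<le> n"
    using assms by linarith
  have card_compl: "card ({..<n} - {b, s}) = n - 2" "card ({..<n} - {b}) = n - 1"
    using vertices distinct by (simp_all add: card_Diff_subset)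
  have exponents: "n - 1 + (n - 2) = 2 * n - 3" "n - 1 + (n - 1 - 1) * (n - (n - 1)) = 2 * n - 3"
    "(n - 2) * (n - (n - 2)) + (n - 1 - (n - 2)) * (n - (n - 1)) = 2 * n - 3"
    using n by auto
  have A: "?P ?A = q ^ (2 * n - 3)"
    using prob_nested_cuts[OF p, of "{a}" "{a, s}" n] vertices distinct exponents
    by (simp add: q_def numeral_2_eq_2)
  have B: "?P ?B = q ^ (2 * n - 3)"
    using prob_nested_cuts[OF p, of "{a}" "{..<n} - {b}" n] vertices distinct exponents
    by (simp add: q_def card_compl del: avoids_Un)
  have "{..<n} - {b, s} \<subseteq> {..<n} - {b}" by auto
  then have C: "?P ?C = q ^ (2 * n - 3)"
    using prob_nested_cuts[OF p, of "{..<n} - {b, s}" "{..<n} - {b}" n]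
    by (simp only: q_def card_compl exponents Diff_subset)
  have I: "?P ?I = (1 - p) ^ (n - 1)"
  proof -
    have "cut_arcs n {s} \<union> cut_arcs n ({..<n} - {s}) = {s} \<times> ({..<n} - {s}) \<union> ({..<n} - {s}) \<times> {s}"
      using vertices by (auto simp: cut_arcs_def)
    then show ?thesis
      using prob_isolated[OF p, of s n] vertices by simp
  qed
  have crowded: "?P (crowded_event n {a, b, s, x, y}) \<le> ?k" if "x < n" "y < n" for x y
    using that vertices card_length[of "[a, b, s, x, y]"] unfolding q_def
    by (intro prob_crowded_event p) auto
  have "?P ?K \<le> (\<Sum>(x, y)\<in>{..<n} \<times> {..<n}. ?P (crowded_event n {a, b, s, x, y}))"
    unfolding case_prod_beta' by (intro measure_pmf.finite_measure_subadditive_finite) auto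
  also have "\<dots> \<le> (\<Sum>(x, y)\<in>{..<n} \<times> {..<n}. ?k)"
    by (intro sum_mono) (auto intro: crowded)
  also have "\<dots> = real n ^ 2 * ?k"
    by (simp add: case_prod_beta' card_cartesian_product power2_eq_square)
  finally have K: "?P ?K \<le> real n ^ 2 * ?k" .
  have "?E \<subseteq> ?A \<union> ?B \<union> ?C \<union> ?I \<union> large_cut_event 3 n \<union> ?K"
    using no_paths_cases[OF vertices distinct] by blast
  then have "?P ?E \<le> ?P (?A \<union> ?B \<union> ?C \<union> ?I \<union> large_cut_event 3 n \<union> ?K)"
    by (intro measure_pmf.finite_measure_mono) auto
  also have "\<dots> \<le> ?P ?A + ?P ?B + ?P ?C + ?P ?I + ?P (large_cut_event 3 n) + ?P ?K"
    by (intro order_trans[OF prob_Un_le] add_mono order_refl)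
  also have "\<dots> \<le> 3 * q ^ (2 * n - 3) + (1 - p) ^ (n - 1) + large_separations 3 n q
      + real n ^ 2 * ?k"
    unfolding A B C I using K prob_large_cut_event[OF p, of n 3] by (simp add: q_def)
  finally have upper: "?P ?E \<le> 3 * q ^ (2 * n - 3) + (1 - p) ^ (n - 1) + large_separations 3 n q
      + real n ^ 2 * ?k" .
  have overlap: "?P Z \<le> ?k" if "Z \<subseteq> crowded_event n {a, b, s}" for Z
  proof -
    have "?P Z \<le> ?P (crowded_event n {a, b, s})"
      using that by (intro measure_pmf.finite_measure_mono) auto
    then show ?thesis
      using crowded[of a a] vertices by (simp add: insert_commute)
  qed
  let ?W = "{a, b, s}"
  have A_out: "?A \<subseteq> avoids ({a, s} \<times> ({..<n} - ?W))"
    unfolding cut_arcs_def by (intro avoids_antimono) auto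
  have B_out: "?B \<subseteq> avoids ({a} \<times> ({..<n} - ?W))"
    unfolding cut_arcs_def by (intro avoids_antimono) auto
  have B_in: "?B \<subseteq> avoids (({..<n} - ?W) \<times> {b})"
    unfolding cut_arcs_def using vertices by (intro avoids_antimono) auto
  have C_in: "?C \<subseteq> avoids (({..<n} - ?W) \<times> {b, s})"
    unfolding cut_arcs_def using vertices by (intro avoids_antimono) auto
  then have C_in': "?C \<subseteq> avoids (({..<n} - ?W) \<times> {b})"
    by (rule order_trans) (auto simp: avoids_def)
  have "?A \<inter> ?B \<subseteq> crowded_event n ?W"
    using A_out B_in crowded_eventI[of _ "{a, s}" n ?W "{b}"] distinct by auto
  moreover have "?A \<inter> ?C \<subseteq> crowded_event n ?W"
    using A_out C_in' crowded_eventI[of _ "{a, s}" n ?W "{b}"] distinct by auto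
  moreover have "?B \<inter> ?C \<subseteq> crowded_event n ?W"
    using B_out C_in crowded_eventI[of _ "{a}" n ?W "{b, s}"] distinct by auto
  ultimately have overlaps: "?P (?A \<inter> ?B) \<le> ?k" "?P (?A \<inter> ?C) \<le> ?k" "?P (?B \<inter> ?C) \<le> ?k"
    by - (rule overlap, assumption)+
  have "?P (?A \<union> ?B \<union> ?C) \<le> ?P ?E"
  proof (rule prob_mono_on_support)
    fix D assume D: "D \<in> ?A \<union> ?B \<union> ?C" "D \<subseteq> {..<n} \<times> {..<n}"
    then obtain U V where "D \<in> avoids (cut_arcs n U)" "D \<in> avoids (cut_arcs n V)"
      "a \<in> U" "s \<notin> U" "s \<in> V" "b \<notin> V"
      using vertices distinct by fastforce
    then show "D \<in> ?E"
      using D(2) by (blast intro: cut_imp_no_path)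
  qed
  then have "3 * q ^ (2 * n - 3) - 3 * ?k \<le> ?P ?E"
    using prob_bonferroni_3[of "random_digraph n p" ?A ?B ?C] overlaps A B C by linarith
  moreover have "0 \<le> large_separations 3 n q" "0 \<le> (1 - p) ^ (n - 1)" "0 \<le> ?k" "0 \<le> real n ^ 2 * ?k"
    using p by (auto simp: large_separations_def q_def intro!: sum_nonneg)
  moreover have "1024 * (real n ^ 2 + 3) * q ^ (3 * (n - 5)) = real n ^ 2 * ?k + 3 * ?k"
    by (simp add: algebra_simps)
  ultimately show ?thesis
    using upper by linarith
qed

section \<open>Asymptotics\<close>

lemma tendsto_of_scaled_error:
  fixes f g e :: "nat \<Rightarrow> real"
  assumes "\<forall>\<^sub>F n in sequentially. \<bar>f n - c * g n\<bar> \<le> e n"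
    and "\<forall>\<^sub>F n in sequentially. 0 < g n" and "(\<lambda>n. e n / g n) \<longlonglongrightarrow> 0"
  shows "(\<lambda>n. f n / g n) \<longlonglongrightarrow> c"
proof -
  have "(\<lambda>n. f n / g n - c) \<longlonglongrightarrow> 0"
  proof (rule Lim_null_comparison)
    show "(\<lambda>n. e n / g n) \<longlonglongrightarrow> 0" by fact
    show "\<forall>\<^sub>F n in sequentially. norm (f n / g n - c) \<le> e n / g n"
      using assms(1,2)
    proof eventually_elim
      case (elim n)
      then have "f n / g n - c = (f n - c * g n) / g n"
        by (simp add: field_simps)
      then show ?case
        using elim by (simp add: divide_right_mono)
    qed
  qed
  then show ?thesis
    by (simp add: LIM_zero_iff)
qed

lemma prob_no_path_asymptotics:
  fixes p :: real and u v :: "nat \<Rightarrow> nat"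
  assumes p: "0 < p" "p \<le> 1"
    and uv: "\<forall>\<^sub>F n in sequentially. u n < n \<and> v n < n \<and> u n \<noteq> v n"
  defines "q \<equiv> 1 - p / 2"
  shows "(\<lambda>n. measure_pmf.prob (random_digraph n p) (no_path_event (u n) (v n)) / q ^ (n - 1))
    \<longlonglongrightarrow> 2"
proof (rule tendsto_of_scaled_error)
  have q: "0 < q" "q < 1"
    using p by (auto simp: q_def)
  show "\<forall>\<^sub>F n in sequentially.
    \<bar>measure_pmf.prob (random_digraph n p) (no_path_event (u n) (v n)) - 2 * q ^ (n - 1)\<bar>
      \<le> large_separations 2 n q + q ^ (2 * (n - 2))"
    using uv
  proof eventually_elim
    case (elim n)
    then show ?case
      unfolding q_def using p by (intro prob_no_path_bounds) auto
  qed
  show "\<forall>\<^sub>F n in sequentially. 0 < q ^ (n - 1)"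
    using q by simp
  have "(\<lambda>n. q * (large_separations (Suc 1) n q / (q ^ 1) ^ n) + q ^ n / q ^ 3) \<longlonglongrightarrow> q * 0 + 0 / q ^ 3"
    using q by (intro tendsto_intros large_separations_negligible LIMSEQ_power_zero) auto
  moreover have "\<forall>\<^sub>F n in sequentially.
      q * (large_separations (Suc 1) n q / (q ^ 1) ^ n) + q ^ n / q ^ 3
      = (large_separations 2 n q + q ^ (2 * (n - 2))) / q ^ (n - 1)"
    using eventually_ge_at_top[of 2]
  proof eventually_elim
    case (elim n)
    then obtain m where m: "n = m + 2"
      by (metis add.commute le_Suc_ex)
    show ?case
      using q unfolding m
      by (simp add: field_simps power_add power2_eq_square eval_nat_numeral mult_2)
  qed
  ultimately show "(\<lambda>n. (large_separations 2 n q + q ^ (2 * (n - 2))) / q ^ (n - 1)) \<longlonglongrightarrow> 0"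
    by (simp add: tendsto_cong)
qed

text \<open>
  Each error term is negligible for its own reason: isolation of \<open>s\<close> because \<open>1 - p < q\<^sup>2\<close>, and the other
  two because they carry an additional factor \<open>q ^ n\<close> up to a polynomial.
\<close>

lemma prob_no_paths_asymptotics:
  fixes p :: real and a b s :: "nat \<Rightarrow> nat"
  assumes p: "0 < p" "p \<le> 1"
    and vertices: "\<forall>\<^sub>F n in sequentially. a n < n \<and> b n < n \<and> s n < n"
    and distinct: "\<forall>\<^sub>F n in sequentially. a n \<noteq> b n \<and> a n \<noteq> s n \<and> b n \<noteq> s n"
  defines "q \<equiv> 1 - p / 2"
  shows "(\<lambda>n. measure_pmf.prob (random_digraph n p)
      (no_path_event (a n) (s n) \<inter> no_path_event (s n) (b n)) / q ^ (2 * n - 3)) \<longlonglongrightarrow> 3"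
proof (rule tendsto_of_scaled_error)
  let ?e = "\<lambda>n. (1 - p) ^ (n - 1) + large_separations 3 n q + 1024 * (real n ^ 2 + 3) * q ^ (3 * (n - 5))"
  have q: "0 < q" "q < 1"
    using p by (auto simp: q_def)
  show "\<forall>\<^sub>F n in sequentially.
    \<bar>measure_pmf.prob (random_digraph n p) (no_path_event (a n) (s n) \<inter> no_path_event (s n) (b n))
      - 3 * q ^ (2 * n - 3)\<bar> \<le> ?e n"
    using vertices distinct
  proof eventually_elim
    case (elim n)
    then show ?case
      unfolding q_def using p by (intro prob_no_paths_bounds) auto
  qed
  show "\<forall>\<^sub>F n in sequentially. 0 < q ^ (2 * n - 3)"
    using q by simp
  have "1 - p < q ^ 2"
    using p by (simp add: q_def power2_eq_square algebra_simps)
  then have r: "0 \<le> (1 - p) / q ^ 2" "(1 - p) / q ^ 2 < 1"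
    using p q by (auto simp: abs_less_iff)
  let ?u = "\<lambda>n. q * ((1 - p) / q ^ 2) ^ (n - 1)
     + q ^ 3 * (large_separations (Suc 2) n q / (q ^ 2) ^ n)
     + 1024 / q ^ 12 * (real n ^ 2 * q ^ n + 3 * (real n ^ 0 * q ^ n))"
  have "?u \<longlonglongrightarrow> q * 0 + q ^ 3 * 0 + 1024 / q ^ 12 * (0 + 3 * 0)"
    using p q r
    by (intro tendsto_intros large_separations_negligible power_times_geometric_tendsto_0
        LIMSEQ_power_zero filterlim_compose[OF LIMSEQ_power_zero filterlim_minus_const_nat_at_top]) auto
  moreover have "\<forall>\<^sub>F n in sequentially. ?u n = ?e n / q ^ (2 * n - 3)"
    using eventually_ge_at_top[of 5]
  proof eventually_elim
    case (elim n)
    \<comment> \<open>The last identity explains \<open>q ^ 12\<close> in \<open>?u\<close>: \<open>3 * 5\<close> for the five vertices that a crowded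
      event ignores, less the \<open>3\<close> subtracted in \<open>2 * n - 3\<close>.\<close>
    have "2 * (n - 1) = Suc (2 * n - 3)" "2 * n = 3 + (2 * n - 3)"
      "n + (2 * n - 3) = 12 + 3 * (n - 5)"
      using elim by linarith+
    then have exponents: "(q ^ 2) ^ (n - 1) = q * q ^ (2 * n - 3)"
      "(q ^ 2) ^ n = q ^ 3 * q ^ (2 * n - 3)"
      "q ^ n * q ^ (2 * n - 3) = q ^ 12 * q ^ (3 * (n - 5))"
      by (metis power_mult power_Suc, metis power_mult power_add, metis power_add)
    have "q * ((1 - p) / q ^ 2) ^ (n - 1) = (1 - p) ^ (n - 1) / q ^ (2 * n - 3)"
      unfolding power_divide exponents using q by simp
    moreover have "q ^ 3 * (large_separations (Suc 2) n q / (q ^ 2) ^ n)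
        = large_separations 3 n q / q ^ (2 * n - 3)"
      unfolding exponents using q by simp
    moreover have "1024 / q ^ 12 * (real n ^ 2 * q ^ n + 3 * (real n ^ 0 * q ^ n))
        = 1024 * (real n ^ 2 + 3) * q ^ (3 * (n - 5)) / q ^ (2 * n - 3)"
    proof -
      have "q ^ n / q ^ 12 = q ^ (3 * (n - 5)) / q ^ (2 * n - 3)"
        using exponents(3) q by (simp add: frac_eq_eq mult.commute)
      then have "1024 * (real n ^ 2 + 3) * (q ^ n / q ^ 12)
          = 1024 * (real n ^ 2 + 3) * (q ^ (3 * (n - 5)) / q ^ (2 * n - 3))"
        by (rule arg_cong)
      then show ?thesis
        by (simp add: algebra_simps add_divide_distrib)
    qed
    ultimately show ?case
      by (simp only: add_divide_distrib)
  qed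
  ultimately show "(\<lambda>n. ?e n / q ^ (2 * n - 3)) \<longlonglongrightarrow> 0"
    by (simp add: tendsto_cong)
qed

text \<open>
  The constant is \<open>3 - 4 * q = 2 * p - 1\<close>: the marginal main terms multiply to \<open>4 * q ^ (2 * n - 2)\<close>, with
  one factor \<open>q\<close> more than the joint one. In each of the three main configurations, the two vertices involved
  share a pair on which only one arc is forbidden.
\<close>

lemma cov_no_paths_asymptotics:
  fixes p :: real and a b s :: "nat \<Rightarrow> nat"
  assumes p: "0 < p" "p \<le> 1"
    and vertices: "\<forall>\<^sub>F n in sequentially. a n < n \<and> b n < n \<and> s n < n"
    and distinct: "\<forall>\<^sub>F n in sequentially. a n \<noteq> b n \<and> a n \<noteq> s n \<and> b n \<noteq> s n"
  shows "(\<lambda>n. event_cov (random_digraph n p)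
      (no_path_event (a n) (s n)) (no_path_event (s n) (b n)) / (1 - p / 2) ^ (2 * n - 3))
    \<longlonglongrightarrow> 2 * p - 1"
proof -
  define q where "q = 1 - p / 2"
  have q: "0 < q"
    using p by (auto simp: q_def)
  define J where "J = (\<lambda>n. measure_pmf.prob (random_digraph n p)
      (no_path_event (a n) (s n) \<inter> no_path_event (s n) (b n)))"
  define P where "P = (\<lambda>n. measure_pmf.prob (random_digraph n p) (no_path_event (a n) (s n)))"
  define R where "R = (\<lambda>n. measure_pmf.prob (random_digraph n p) (no_path_event (s n) (b n)))"
  have "(\<lambda>n. J n / q ^ (2 * n - 3)) \<longlonglongrightarrow> 3"
    unfolding J_def q_def by (intro prob_no_paths_asymptotics assms)
  moreover have "(\<lambda>n. P n / q ^ (n - 1)) \<longlonglongrightarrow> 2"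
    unfolding P_def q_def using vertices distinct
    by (intro prob_no_path_asymptotics p) (auto elim: eventually_elim2)
  moreover have "(\<lambda>n. R n / q ^ (n - 1)) \<longlonglongrightarrow> 2"
    unfolding R_def q_def using vertices distinct
    by (intro prob_no_path_asymptotics p) (auto elim: eventually_elim2)
  ultimately have "(\<lambda>n. J n / q ^ (2 * n - 3) - q * (P n / q ^ (n - 1)) * (R n / q ^ (n - 1)))
      \<longlonglongrightarrow> 3 - q * 2 * 2"
    by (intro tendsto_intros)
  moreover have "\<forall>\<^sub>F n in sequentially.
      J n / q ^ (2 * n - 3) - q * (P n / q ^ (n - 1)) * (R n / q ^ (n - 1))
      = (J n - P n * R n) / q ^ (2 * n - 3)"
    using eventually_ge_at_top[of 2]
  proof eventually_elim
    case (elim n)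
    then have "n - 1 + (n - 1) = Suc (2 * n - 3)"
      by linarith
    then have "q ^ (2 * n - 3) * q = q ^ (n - 1) * q ^ (n - 1)"
      by (metis power_add power_Suc2)
    then have "1 / q ^ (2 * n - 3) = q / (q ^ (n - 1) * q ^ (n - 1))"
      using q by (simp add: field_simps)
    then have "x / q ^ (2 * n - 3) = q * x / (q ^ (n - 1) * q ^ (n - 1))" for x
      by (metis (no_types) times_divide_eq_left mult.commute mult_1 times_divide_eq_right)
    from this[of "P n * R n"] show ?case
      by (simp add: diff_divide_distrib)
  qed
  ultimately have "(\<lambda>n. (J n - P n * R n) / q ^ (2 * n - 3)) \<longlonglongrightarrow> 3 - q * 2 * 2"
    by (rule Lim_transform_eventually)
  also have "3 - q * 2 * 2 = 2 * p - 1"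
    by (simp add: q_def)
  finally show ?thesis
    by (simp add: event_cov_def J_def P_def R_def q_def)
qed

lemma event_cov_commute: "event_cov M A B = event_cov M B A"
  by (simp add: event_cov_def Int_commute mult.commute)

theorem theorem2p1:
  fixes p :: real and a b s :: "nat \<Rightarrow> nat"
  assumes p: "0 < p" "p \<le> 1"
    and vertices: "\<And>n. n \<ge> 3 \<Longrightarrow> a n < n \<and> b n < n \<and> s n < n"
    and distinct_vertices: "\<And>n. n \<ge> 3 \<Longrightarrow> a n \<noteq> b n \<and> a n \<noteq> s n \<and> b n \<noteq> s n"
  shows
    "((\<lambda>n. (measure_pmf.prob (random_digraph n p)
                (no_path_event (a n) (s n) \<inter> no_path_event (s n) (b n))
             - measure_pmf.prob (random_digraph n p) (no_path_event (a n) (s n))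
               * measure_pmf.prob (random_digraph n p) (no_path_event (s n) (b n)))
            / measure_pmf.prob (random_digraph n p)
                (no_path_event (a n) (s n) \<inter> no_path_event (s n) (b n)))
        \<longlonglongrightarrow> (2 * p - 1) / 3)
     \<and> (p < 1 / 2 \<longrightarrow>
          (\<forall>\<^sub>F n in sequentially.
             event_cov (random_digraph n p)
               (no_path_event (s n) (a n)) (no_path_event (b n) (s n)) < 0))
     \<and> (1 / 2 < p \<longrightarrow>
          (\<forall>\<^sub>F n in sequentially.
             event_cov (random_digraph n p)
               (no_path_event (s n) (a n)) (no_path_event (b n) (s n)) > 0))
     \<and> (\<exists>\<epsilon> :: nat \<Rightarrow> real. \<epsilon> \<in> o(\<lambda>_. 1) \<and>
          (\<forall>n\<ge>3. event_cov (random_digraph n p)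
               (no_path_event (s n) (a n)) (no_path_event (b n) (s n))
             = (2 * p - 1 + \<epsilon> n) * (1 - p / 2) ^ (2 * n - 3)))"
proof -
  define q where "q = 1 - p / 2"
  have q: "0 < q ^ k" for k
    using p by (auto simp: q_def)
  have vertices': "\<forall>\<^sub>F n in sequentially. a n < n \<and> b n < n \<and> s n < n"
    using eventually_ge_at_top[of 3] by eventually_elim (rule vertices)
  have distinct': "\<forall>\<^sub>F n in sequentially. a n \<noteq> b n \<and> a n \<noteq> s n \<and> b n \<noteq> s n"
    using eventually_ge_at_top[of 3] by eventually_elim (rule distinct_vertices)
  define J where "J = (\<lambda>n. measure_pmf.prob (random_digraph n p)
      (no_path_event (a n) (s n) \<inter> no_path_event (s n) (b n)))"
  define cov where "cov = (\<lambda>n. event_cov (random_digraph n p)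
      (no_path_event (a n) (s n)) (no_path_event (s n) (b n)))"
  define cov' where "cov' = (\<lambda>n. event_cov (random_digraph n p)
      (no_path_event (s n) (a n)) (no_path_event (b n) (s n)))"
  have J_lim: "(\<lambda>n. J n / q ^ (2 * n - 3)) \<longlonglongrightarrow> 3"
    unfolding J_def q_def by (intro prob_no_paths_asymptotics p vertices' distinct')
  have cov_lim: "(\<lambda>n. cov n / q ^ (2 * n - 3)) \<longlonglongrightarrow> 2 * p - 1"
    unfolding cov_def q_def by (intro cov_no_paths_asymptotics p vertices' distinct')
  \<comment> \<open>\<open>cov'\<close> is \<open>cov\<close> with the roles of \<open>a\<close> and \<open>b\<close> exchanged.\<close>
  have cov'_lim: "(\<lambda>n. cov' n / q ^ (2 * n - 3)) \<longlonglongrightarrow> 2 * p - 1"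
    unfolding cov'_def q_def event_cov_commute[of _ "no_path_event (s _) (a _)"]
    using vertices' distinct'
    by (intro cov_no_paths_asymptotics p) (auto elim: eventually_mono)
  have "(\<lambda>n. cov n / q ^ (2 * n - 3) / (J n / q ^ (2 * n - 3))) \<longlonglongrightarrow> (2 * p - 1) / 3"
    by (intro tendsto_divide cov_lim J_lim) simp
  then have "(\<lambda>n. cov n / J n) \<longlonglongrightarrow> (2 * p - 1) / 3"
    using q[of 1] by simp
  moreover have "\<forall>\<^sub>F n in sequentially. cov' n < 0" if "p < 1 / 2"
  proof -
    have "\<forall>\<^sub>F n in sequentially. cov' n / q ^ (2 * n - 3) < 0"
      using that by (intro order_tendstoD[OF cov'_lim]) simp
    then show ?thesis
      using q[of 1] by (simp add: divide_less_0_iff order.asym)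
  qed
  moreover have "\<forall>\<^sub>F n in sequentially. cov' n > 0" if "1 / 2 < p"
  proof -
    have "\<forall>\<^sub>F n in sequentially. cov' n / q ^ (2 * n - 3) > 0"
      using that by (intro order_tendstoD[OF cov'_lim]) simp
    then show ?thesis
      using q[of 1] by (simp add: zero_less_divide_iff order.asym)
  qed
  moreover have "\<exists>\<epsilon> :: nat \<Rightarrow> real. \<epsilon> \<in> o(\<lambda>_. 1) \<and>
      (\<forall>n\<ge>3. cov' n = (2 * p - 1 + \<epsilon> n) * q ^ (2 * n - 3))"
  proof (intro exI conjI allI impI)
    let ?\<epsilon> = "\<lambda>n. cov' n / q ^ (2 * n - 3) - (2 * p - 1)"
    have "?\<epsilon> \<longlonglongrightarrow> 0"
      using cov'_lim by (simp only: LIM_zero_iff)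
    then show "?\<epsilon> \<in> o(\<lambda>_. 1)"
      by (intro smalloI_tendsto) auto
    show "cov' n = (2 * p - 1 + ?\<epsilon> n) * q ^ (2 * n - 3)" for n
      using q[of "2 * n - 3"] q[of 1] by simp
  qed
  ultimately show ?thesis
    unfolding J_def cov_def cov'_def q_def event_cov_def by blast
qed

end
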